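(* Let $n\ge3$ and $S\subseteq[3,n]$ with $CP_n(S)\ne\emptyset$, and suppose $S$ has type $(r_1^{k_1},r_2^{k_2},\dots,r_m^{k_m})$ with $m\ge2$. Then, with $i_0=0$, $$cp_n(S)=2^{n-r_m}\sum_{i_1=0}^{k_m}\sum_{i_2=0}^{k_{m-1}+i_1}\cdots\sum_{i_{m-1}=0}^{k_2+i_{m-2}}\ \prod_{j=1}^{m-1}w\big(i_j,\,r_{m-j},\,r_{m-j+1}+i_{j-1}-i_j,\,k_{m-j+1}+i_{j-1}-i_j\big)\ cp_{r_1+i_{m-1}}\big([r_1-k_1+1,\,r_1+i_{m-1}]\big).$$
   Context: For integers $a \le b$, $[a,b]=\{a,a+1,\dots,b\}$, $[a,b]=\emptyset$ if $a>b$, and $[n]=[1,n]$. For $N\ge1$, $\mathfrak{S}_N$ is the set of permutations of $[N]$, in one-line form $\sigma=(\sigma(1)\cdots\sigma(N))$; $CP(\sigma)=\{\sigma(i) : 2\le i\le N-1,\ \sigma(i-1)<\sigma(i)>\sigma(i+1)\}$; for $T\subseteq[N]$, $CP_N(T)=\{\sigma\in\mathfrak{S}_N : CP(\sigma)=T\}$ and $cp_N(T)=|CP_N(T)|$. Type: a set $S\subseteq[3,n]$ has type $(r_1^{k_1},\dots,r_m^{k_m})$ (with positive integers $k_i$) if $S=\bigcup_{i=1}^m[r_i-k_i+1,r_i]$ and $r_i\le r_{i+1}-k_{i+1}-1$ for all $i\in[1,m-1]$. Circular-peak paths and $w$: a circular-peak path from $(r,0)$ to $(N,k)$ is a lattice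 path in the first quadrant from $(r,0)$ to $(N,k)$ using only steps $H=(1,0)$ and $R=(2,1)$; $P_{r,N,k}$ is the set of such paths. For an integer $i$, an $H$-step from $(x,y)$ to $(x+1,y)$ has weight $2i+2(y+1)$, and an $R$-step from $(x,y)$ to $(x+2,y+1)$ has weight $(y+i+1)(y+i+2)$; $w_i(P)$ is the product of the step weights of $P$, and $w(i,r,N,k)=\sum_{P\in P_{r,N,k}}w_i(P)$ (an empty sum being $0$). *)

theory Defs
  imports Complex_Main "HOL-Combinatorics.Permutations"
begin

text \<open>Permutations of \<open>[N]\<close> are functions that permute \<open>{1..N}\<close> (the identity elsewhere).\<close>

definition CP :: "nat \<Rightarrow> (nat \<Rightarrow> nat) \<Rightarrow> nat set" where
  "CP N \<sigma> = {\<sigma> i | i. 2 \<le> i \<and> i + 1 \<le> N \<and> \<sigma> (i - 1) < \<sigma> i \<and> \<sigma> i > \<sigma> (i + 1)}"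

definition CP_perms :: "nat \<Rightarrow> nat set \<Rightarrow> (nat \<Rightarrow> nat) set" where
  "CP_perms N T = {\<sigma>. \<sigma> permutes {1..N} \<and> CP N \<sigma> = T}"

definition cp :: "nat \<Rightarrow> nat set \<Rightarrow> nat" where
  "cp N T = card (CP_perms N T)"

lemma finite_CP_perms: "finite (CP_perms N T)"
  unfolding CP_perms_def by (rule finite_subset[OF _ finite_permutations[of "{1..N}"]]) auto

text \<open>
  \<open>S\<close> has type \<open>(r\<^sub>1^k\<^sub>1, \<dots>, r\<^sub>m^k\<^sub>m)\<close>; only the values of \<open>r\<close> and \<open>k\<close> on \<open>{1..m}\<close> matter.
  Subtraction on \<open>nat\<close> truncates: the lower bound is written \<open>r i + 1 - k i\<close> rather than
  \<open>r i - k i + 1\<close>, so that a block with \<open>k i > r i\<close> contains \<open>0\<close> and is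
  excluded as soon as \<open>S \<subseteq> {3..n}\<close>; the gap condition is written additively.
\<close>

definition has_type :: "nat set \<Rightarrow> nat \<Rightarrow> (nat \<Rightarrow> nat) \<Rightarrow> (nat \<Rightarrow> nat) \<Rightarrow> bool" where
  "has_type S m r k \<longleftrightarrow>
     (\<forall>i\<in>{1..m}. k i > 0) \<and>
     S = (\<Union>i\<in>{1..m}. {r i + 1 - k i..r i}) \<and>
     (\<forall>i\<in>{1..m - 1}. r i + k (i + 1) + 1 \<le> r (i + 1))"

text \<open>
  Lattice paths are lists of steps; working in \<open>nat \<times> nat\<close> keeps them in the first quadrant.
\<close>

datatype cp_step = H | R

fun step_end :: "nat \<times> nat \<Rightarrow> cp_step \<Rightarrow> nat \<times> nat" where
  "step_end (x, y) H = (x + 1, y)"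
| "step_end (x, y) R = (x + 2, y + 1)"

definition cp_paths :: "nat \<Rightarrow> nat \<Rightarrow> nat \<Rightarrow> cp_step list set" where
  "cp_paths r N k = {P. foldl step_end (r, 0) P = (N, k)}"

fun step_weight :: "int \<Rightarrow> nat \<times> nat \<Rightarrow> cp_step \<Rightarrow> int" where
  "step_weight i (x, y) H = 2 * i + 2 * (int y + 1)"
| "step_weight i (x, y) R = (int y + i + 1) * (int y + i + 2)"

text \<open>The second argument is the starting point of the path.\<close>

fun path_weight :: "int \<Rightarrow> nat \<times> nat \<Rightarrow> cp_step list \<Rightarrow> int" where
  "path_weight i p [] = 1"
| "path_weight i p (s # P) = step_weight i p s * path_weight i (step_end p s) P"

definition w :: "int \<Rightarrow> nat \<Rightarrow> nat \<Rightarrow> nat \<Rightarrow> int" where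
  "w i r N k = (\<Sum>P\<in>cp_paths r N k. path_weight i (r, 0) P)"

lemma fst_foldl_step_end: "fst p + length P \<le> fst (foldl step_end p P)"
proof (induction P arbitrary: p)
  case Nil
  then show ?case by simp
next
  case (Cons s P)
  have "fst p + 1 \<le> fst (step_end p s)" by (cases p; cases s) auto
  then show ?case using Cons[of "step_end p s"] by simp
qed

lemma finite_cp_paths: "finite (cp_paths r N k)"
proof (rule finite_subset)
  have "(UNIV :: cp_step set) = {H, R}" using cp_step.exhaust by auto
  then have "finite (UNIV :: cp_step set)" by (metis finite.simps)
  then show "finite {P :: cp_step list. set P \<subseteq> UNIV \<and> length P \<le> N}"
    by (rule finite_lists_length_le)
  show "cp_paths r N k \<subseteq> {P. set P \<subseteq> UNIV \<and> length P \<le> N}"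
  proof
    fix P assume "P \<in> cp_paths r N k"
    then show "P \<in> {P. set P \<subseteq> UNIV \<and> length P \<le> N}"
      using fst_foldl_step_end[of "(r, 0)" P] by (simp add: cp_paths_def)
  qed
qed

text \<open>
  The index range of the iterated sum
  \<open>\<Sum>i\<^sub>1=0..k\<^sub>m. \<Sum>i\<^sub>2=0..k\<^bsub>m-1\<^esub>+i\<^sub>1. \<dots> \<Sum>i\<^bsub>m-1\<^esub>=0..k\<^sub>2+i\<^bsub>m-2\<^esub>\<close> with \<open>i\<^sub>0 = 0\<close>: tuples
  \<open>(i\<^sub>0, \<dots>, i\<^bsub>m-1\<^esub>)\<close>, encoded as functions that vanish from \<open>m\<close> on.
  The bound on \<open>i j\<close> makes \<open>k (m - j + 1) + i (j - 1) - i j\<close> a true subtraction, and likewise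
  \<open>r (m - j + 1) + i (j - 1) - i j\<close> for the \<open>r\<close> and \<open>k\<close> of a type (where \<open>k l \<le> r l\<close>).
\<close>

definition index_tuples :: "nat \<Rightarrow> (nat \<Rightarrow> nat) \<Rightarrow> (nat \<Rightarrow> nat) set" where
  "index_tuples m k =
     {i. i 0 = 0 \<and> (\<forall>j\<in>{1..m - 1}. i j \<le> k (m - j + 1) + i (j - 1)) \<and> (\<forall>j\<ge>m. i j = 0)}"

lemma finite_index_tuples: "finite (index_tuples m k)"
proof (rule finite_subset)
  define B where "B = (\<Sum>l\<le>m. k l)"
  have bound: "i j \<le> B * j" if i: "i \<in> index_tuples m k" and "j < m" for i j
    using \<open>j < m\<close>
  proof (induction j)
    case 0
    then show ?case using i by (simp add: index_tuples_def)
  next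
    case (Suc j)
    have "i (Suc j) \<le> k (m - Suc j + 1) + i j"
      using i Suc.prems by (auto simp: index_tuples_def dest: bspec[where x = "Suc j"])
    moreover have "k (m - Suc j + 1) \<le> B"
      unfolding B_def using Suc.prems by (intro member_le_sum) auto
    ultimately show ?case using Suc by simp
  qed
  show "index_tuples m k \<subseteq> {i. \<forall>j. (j \<in> {..<m} \<longrightarrow> i j \<in> {..B * m}) \<and> (j \<notin> {..<m} \<longrightarrow> i j = 0)}"
    using bound by (auto simp: index_tuples_def intro: order_trans[OF bound])
  show "finite {i. \<forall>j. (j \<in> {..<m} \<longrightarrow> i j \<in> {..B * m}) \<and> (j \<notin> {..<m} \<longrightarrow> i j = (0::nat))}"
    by (rule finite_set_of_finite_funs) auto
qed

end

theory Submission
  imports Defs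
begin

text \<open>
  Inserting \<open>N + 1\<close> at an end of a permutation of \<open>[N]\<close> keeps its peak set, and inserting it in an
  interior gap creates the peak \<open>N + 1\<close> and destroys an adjacent one. This gives a recurrence for
  \<open>cp\<^bsub>N+1\<^esub>(T \<union> {N+1})\<close> in terms of \<open>cp\<^sub>N(T)\<close> and the \<open>cp\<^sub>N(T \<union> {q})\<close>. From it one derives, writing
  \<open>f g K\<close> for the number of permutations of \<open>[r+g+K]\<close> with peak set \<open>T \<union> [r+g+1, r+g+K]\<close>, the relation
  \<open>f (g+1) K = 2(K+1) f g K + K(K+1) f g (K-1)\<close>, which no longer changes \<open>T\<close>. Iterating it down to
  \<open>g = 0\<close> is a sum over circular-peak paths read from their last step: the paths ending at height \<open>K - i\<close>
  with parameter \<open>i\<close> collect the coefficient of \<open>f 0 i\<close>, since both weights depend only on \<open>i\<close> plus the height.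
  Each gap of the type of \<open>S\<close> is removed in this way, from the top one down, and contributes one
  summation index.
\<close>

section \<open>Inserting the largest value into a permutation\<close>

text \<open>\<open>p\<close> is the position that \<open>Suc N\<close> receives. The last branch is
  the identity outside \<open>{1..Suc N}\<close>, as \<open>permutes\<close> demands.\<close>

definition insert_max :: "nat \<Rightarrow> nat \<Rightarrow> (nat \<Rightarrow> nat) \<Rightarrow> nat \<Rightarrow> nat" where
  "insert_max N p \<sigma> i =
     (if i < p then \<sigma> i else if i = p then Suc N else if i \<le> Suc N then \<sigma> (i - 1) else i)"

lemma insert_max_permutes:
  assumes s: "\<sigma> permutes {1..N}" and p: "p \<in> {1..Suc N}"
  shows "insert_max N p \<sigma> permutes {1..Suc N}"
proof (rule bij_imp_permutes)
  have into: "\<sigma> i \<in> {1..N}" if "i \<in> {1..N}" for i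
    using permutes_in_image[OF s] that by blast
  have inj: "\<sigma> i = \<sigma> j \<longleftrightarrow> i = j" for i j
    using permutes_inj[OF s] by (auto dest: injD)
  have sub: "insert_max N p \<sigma> ` {1..Suc N} \<subseteq> {1..Suc N}"
  proof
    fix y assume "y \<in> insert_max N p \<sigma> ` {1..Suc N}"
    then obtain i where i: "i \<in> {1..Suc N}" and y: "y = insert_max N p \<sigma> i" by blast
    consider "i < p" | "i = p" | "i > p" by linarith
    then show "y \<in> {1..Suc N}"
    proof cases
      case 1
      then show ?thesis using into[of i] i p unfolding y insert_max_def by auto
    next
      case 2
      then show ?thesis unfolding y insert_max_def by simp
    next
      case 3
      then have "i - 1 \<in> {1..N}" using i p by auto
      from into[OF this] 3 show ?thesis using i unfolding y insert_max_def by simp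
    qed
  qed
  have ne: "\<sigma> i \<noteq> Suc N" if "1 \<le> i" "i < p" for i
    using into[of i] that p by auto
  have ne': "\<sigma> (i - 1) \<noteq> Suc N" if "p < i" "i \<le> Suc N" for i
  proof -
    have "i - 1 \<in> {1..N}" using that p by auto
    from into[OF this] show ?thesis by auto
  qed
  have "inj_on (insert_max N p \<sigma>) {1..Suc N}"
  proof (rule inj_onI)
    fix i j assume i: "i \<in> {1..Suc N}" and j: "j \<in> {1..Suc N}"
      and eq: "insert_max N p \<sigma> i = insert_max N p \<sigma> j"
    show "i = j"
      using i j p eq ne[of i] ne[of j] ne'[of i] ne'[of j]
      unfolding insert_max_def by (auto simp: inj split: if_splits)
  qed
  then show "bij_betw (insert_max N p \<sigma>) {1..Suc N} {1..Suc N}"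
    using endo_inj_surj[OF _ sub] by (auto simp: bij_betw_def)
  show "insert_max N p \<sigma> i = i" if "i \<notin> {1..Suc N}" for i
    using that p permutes_not_in[OF s, of i] unfolding insert_max_def by auto
qed

text \<open>The slot \<open>p\<close> is recovered as the position of the value
  \<open>Suc N\<close>, which gives injectivity; surjectivity follows because both sides have
  \<open>(N + 1)!\<close> elements.\<close>

lemma bij_betw_insert_max:
  "bij_betw (\<lambda>(p, \<sigma>). insert_max N p \<sigma>)
     ({1..Suc N} \<times> {\<sigma>. \<sigma> permutes {1..N}}) {\<tau>. \<tau> permutes {1..Suc N}}"
proof -
  let ?A = "{1..Suc N} \<times> {\<sigma>. \<sigma> permutes {1..N}}"
  have inj: "inj_on (\<lambda>(p, \<sigma>). insert_max N p \<sigma>) ?A"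
  proof (rule inj_onI; clarify)
    fix p \<sigma> q \<tau>
    assume p: "p \<in> {1..Suc N}" and q: "q \<in> {1..Suc N}"
      and s: "\<sigma> permutes {1..N}" and t: "\<tau> permutes {1..N}"
      and eq: "insert_max N p \<sigma> = insert_max N q \<tau>"
    have "insert_max N q \<tau> p = insert_max N q \<tau> q"
      using fun_cong[OF eq, of p] by (simp add: insert_max_def)
    then have pq: "p = q"
      using permutes_inj[OF insert_max_permutes[OF t q]] by (auto dest: injD)
    have "\<sigma> i = \<tau> i" for i
    proof (cases "i \<in> {1..N}")
      case True
      then show ?thesis
        using fun_cong[OF eq, of i] fun_cong[OF eq, of "Suc i"] pq
        by (cases "i < p") (auto simp: insert_max_def)
    next
      case False
      then show ?thesis using permutes_not_in[OF s] permutes_not_in[OF t] by simp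
    qed
    then show "p = q \<and> \<sigma> = \<tau>" using pq by auto
  qed
  have fin: "finite {\<tau>. \<tau> permutes {1..Suc N}}" by (rule finite_permutations) simp
  have "card ?A = card {\<tau>. \<tau> permutes {1..Suc N}}"
    by (simp add: card_cartesian_product card_permutations[of _ N] card_permutations[of _ "Suc N"])
  moreover have "(\<lambda>(p, \<sigma>). insert_max N p \<sigma>) ` ?A \<subseteq> {\<tau>. \<tau> permutes {1..Suc N}}"
    using insert_max_permutes by auto
  ultimately have "(\<lambda>(p, \<sigma>). insert_max N p \<sigma>) ` ?A = {\<tau>. \<tau> permutes {1..Suc N}}"
    using card_subset_eq[OF fin] card_image[OF inj] by simp
  with inj show ?thesis by (simp add: bij_betw_def)
qed

section \<open>Peaks before and after an insertion\<close>

text \<open>\<open>CP\<close> collects values, but adjacency concerns positions: an insertion shifts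
  positions, and two consecutive positions are never both peaks.\<close>

definition peak_positions :: "nat \<Rightarrow> (nat \<Rightarrow> nat) \<Rightarrow> nat set" where
  "peak_positions N \<sigma> = {i. 2 \<le> i \<and> i + 1 \<le> N \<and> \<sigma> (i - 1) < \<sigma> i \<and> \<sigma> i > \<sigma> (i + 1)}"

lemma CP_eq_image: "CP N \<sigma> = \<sigma> ` peak_positions N \<sigma>"
  unfolding CP_def peak_positions_def by blast

lemma peak_positions_subset: "peak_positions N \<sigma> \<subseteq> {2..N}"
  unfolding peak_positions_def by auto

lemma Suc_peak_notin: "i \<in> peak_positions N \<sigma> \<Longrightarrow> Suc i \<notin> peak_positions N \<sigma>"
  unfolding peak_positions_def by auto

lemma in_CP_iff: "\<sigma> permutes A \<Longrightarrow> \<sigma> i \<in> CP N \<sigma> \<longleftrightarrow> i \<in> peak_positions N \<sigma>"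
  unfolding CP_eq_image by (meson inj_image_mem_iff permutes_inj)

lemma CP_subset:
  assumes "\<sigma> permutes {1..N}"
  shows "CP N \<sigma> \<subseteq> {1..N}"
  using permutes_image[OF assms] peak_positions_subset[of N \<sigma>] unfolding CP_eq_image by force

text \<open>The entries at \<open>p - 1\<close> and \<open>p\<close> become neighbours of
  \<open>Suc N\<close> and cannot be peaks; every other interior entry keeps both its
  neighbours.\<close>

lemma CP_insert_max_interior:
  assumes s: "\<sigma> permutes {1..N}" and p: "p \<in> {2..N}"
  shows "CP (Suc N) (insert_max N p \<sigma>) = insert (Suc N) (CP N \<sigma> - {\<sigma> (p - 1), \<sigma> p})"
proof -
  let ?t = "insert_max N p \<sigma>"
  have le: "\<sigma> i \<le> N" if "i \<le> N" for i
    using permutes_in_image[OF s, of i] permutes_not_in[OF s, of i] that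
    by (cases "i \<in> {1..N}") auto
  have lt: "\<sigma> i < Suc N" if "i \<le> N" for i using le[OF that] by simp
  have inj: "\<sigma> i = \<sigma> j \<longleftrightarrow> i = j" for i j
    using permutes_inj[OF s] by (auto dest: injD)
  define Q where "Q = peak_positions N \<sigma> - {p - 1, p}"
  have pk: "peak_positions (Suc N) ?t = insert p ((\<lambda>i. if i < p then i else Suc i) ` Q)"
  proof (rule set_eqI)
    fix i
    \<comment> \<open>Positions \<open>p - 1\<close> and \<open>Suc p\<close> flank the new maximum;
      further out, the triple around \<open>i\<close> is an old one, shifted by one on the
      right.\<close>
    consider "i + 1 < p" | "i + 1 = p" | "i = p" | "i = Suc p" | "i > Suc p" by linarith
    then show "i \<in> peak_positions (Suc N) ?t \<longleftrightarrow> i \<in> insert p ((\<lambda>i. if i < p then i else Suc i) ` Q)"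
    proof cases
      case 1
      then show ?thesis using p
        by (auto simp: peak_positions_def Q_def insert_max_def image_iff)
    next
      case 2
      then have "i \<notin> peak_positions (Suc N) ?t" using p lt[of i]
        by (auto simp: peak_positions_def insert_max_def)
      then show ?thesis using 2 p by (auto simp: Q_def image_iff split: if_splits)
    next
      case 3
      have "p \<in> peak_positions (Suc N) ?t" using p lt[of "p - 1"] lt[of p]
        by (auto simp: peak_positions_def insert_max_def)
      then show ?thesis using 3 by simp
    next
      case 4
      then have "i \<notin> peak_positions (Suc N) ?t" using p lt[of p]
        by (auto simp: peak_positions_def insert_max_def)
      then show ?thesis using 4 p by (auto simp: Q_def image_iff split: if_splits)
    next
      case 5
      then obtain j where j: "i = Suc j" "j > p" by (cases i) auto
      have "i \<in> peak_positions (Suc N) ?t \<longleftrightarrow> j \<in> peak_positions N \<sigma>"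
        using j p by (auto simp: peak_positions_def insert_max_def)
      then show ?thesis using j by (auto simp: Q_def image_iff split: if_splits)
    qed
  qed
  have "?t (if i < p then i else Suc i) = \<sigma> i" if "i \<in> Q" for i
    using that p peak_positions_subset[of N \<sigma>] by (auto simp: Q_def insert_max_def)
  then have "?t ` (\<lambda>i. if i < p then i else Suc i) ` Q = \<sigma> ` Q"
    unfolding image_image by (intro image_cong) auto
  moreover have "\<sigma> ` Q = CP N \<sigma> - {\<sigma> (p - 1), \<sigma> p}"
    unfolding Q_def CP_eq_image using permutes_inj[OF s] by (simp add: image_set_diff)
  moreover have "?t p = Suc N" by (simp add: insert_max_def)
  ultimately show ?thesis unfolding CP_eq_image[of "Suc N"] pk by simp
qed

text \<open>\<open>Suc N\<close> at an end is not a peak, and the old end entry, now interior, has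
  the larger \<open>Suc N\<close> beside it.\<close>

lemma CP_insert_max_end:
  assumes s: "\<sigma> permutes {1..N}" and p: "p = 1 \<or> p = Suc N"
  shows "CP (Suc N) (insert_max N p \<sigma>) = CP N \<sigma>"
proof -
  let ?t = "insert_max N p \<sigma>"
  have lt: "\<sigma> i < Suc N" if "i \<le> N" for i
    using permutes_in_image[OF s, of i] permutes_not_in[OF s, of i] that
    by (cases "i \<in> {1..N}") auto
  show ?thesis
    using p
  proof
    assume p: "p = 1"
    have "peak_positions (Suc N) ?t = Suc ` peak_positions N \<sigma>"
    proof (rule set_eqI)
      fix i :: nat
      consider "i \<le> 1" | "i = 2" | "i \<ge> 3" by linarith
      then show "i \<in> peak_positions (Suc N) ?t \<longleftrightarrow> i \<in> Suc ` peak_positions N \<sigma>"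
      proof cases
        case 1
        then show ?thesis by (auto simp: peak_positions_def)
      next
        case 2
        then show ?thesis using p lt[of 1] by (auto simp: peak_positions_def insert_max_def)
      next
        case 3
        then obtain j where "i = Suc j" "j \<ge> 2" by (cases i) auto
        then show ?thesis using p by (auto simp: peak_positions_def insert_max_def image_iff)
      qed
    qed
    moreover have "?t (Suc i) = \<sigma> i" if "i \<in> peak_positions N \<sigma>" for i
      using that p by (auto simp: peak_positions_def insert_max_def)
    ultimately show ?thesis by (simp add: CP_eq_image image_image)
  next
    assume p: "p = Suc N"
    have "peak_positions (Suc N) ?t = peak_positions N \<sigma>"
    proof (rule set_eqI)
      fix i
      consider "i < N" | "i = N" | "i > N" by linarith
      then show "i \<in> peak_positions (Suc N) ?t \<longleftrightarrow> i \<in> peak_positions N \<sigma>"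
        using p lt[of N] by cases (auto simp: peak_positions_def insert_max_def)
    qed
    moreover have "?t i = \<sigma> i" if "i \<in> peak_positions N \<sigma>" for i
      using that p by (auto simp: peak_positions_def insert_max_def)
    ultimately show ?thesis by (simp add: CP_eq_image)
  qed
qed

section \<open>Counting the slots with a given effect\<close>

text \<open>Each peak position \<open>i\<close> rules out the slots \<open>i\<close> and
  \<open>Suc i\<close> among the \<open>N - 1\<close> interior ones; these pairs are disjoint
  because consecutive positions are not both peaks.\<close>

lemma card_slots_away_from_peaks:
  assumes s: "\<sigma> permutes {1..N}" and N: "N \<ge> 1" and T: "CP N \<sigma> = T"
  shows "int (card {p\<in>{2..N}. CP N \<sigma> - {\<sigma> (p - 1), \<sigma> p} = T}) = int N - 1 - 2 * int (card T)"
proof -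
  let ?Q = "peak_positions N \<sigma>"
  have fin: "finite ?Q" using peak_positions_subset[of N \<sigma>] finite_subset by blast
  have "inj_on \<sigma> ?Q" using permutes_inj[OF s] inj_on_subset by blast
  then have cT: "card T = card ?Q" unfolding T[symmetric] CP_eq_image by (rule card_image)
  have sub: "?Q \<union> Suc ` ?Q \<subseteq> {2..N}" unfolding peak_positions_def by auto
  have "{p\<in>{2..N}. CP N \<sigma> - {\<sigma> (p - 1), \<sigma> p} = T} =
      {p\<in>{2..N}. p - 1 \<notin> ?Q \<and> p \<notin> ?Q}"
    unfolding in_CP_iff[OF s, symmetric] T by auto
  also have "\<dots> = {2..N} - (?Q \<union> Suc ` ?Q)"
    by (auto simp: image_iff) (metis One_nat_def Suc_pred' less_le_trans zero_less_numeral)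
  finally have eq: "{p\<in>{2..N}. CP N \<sigma> - {\<sigma> (p - 1), \<sigma> p} = T} = {2..N} - (?Q \<union> Suc ` ?Q)" .
  have "card (?Q \<union> Suc ` ?Q) = 2 * card ?Q"
    using fin Suc_peak_notin[of _ N \<sigma>]
    by (subst card_Un_disjoint) (auto simp: card_image)
  moreover have "card ({2..N} - (?Q \<union> Suc ` ?Q)) + card (?Q \<union> Suc ` ?Q) = N - 1"
    using card_mono[OF _ sub] by (subst card_Diff_subset) (use fin sub in auto)
  ultimately show ?thesis unfolding eq cT using N by linarith
qed

text \<open>Only the slots on either side of \<open>q\<close> destroy this peak, and both spare the
  others because the neighbours of a peak are not peaks.\<close>

lemma card_slots_at_peak:
  assumes s: "\<sigma> permutes {1..N}" and q: "q \<notin> T" and T: "CP N \<sigma> = insert q T"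
  shows "card {p\<in>{2..N}. CP N \<sigma> - {\<sigma> (p - 1), \<sigma> p} = T} = 2"
proof -
  obtain i where i: "i \<in> peak_positions N \<sigma>" "q = \<sigma> i" using T unfolding CP_eq_image by blast
  have inj: "\<sigma> i = \<sigma> j \<longleftrightarrow> i = j" for i j
    using permutes_inj[OF s] by (auto dest: injD)
  have "CP N \<sigma> - {\<sigma> (p - 1), \<sigma> p} = T \<longleftrightarrow> p = i \<or> p = Suc i" if "p \<in> {2..N}" for p
  proof
    assume "CP N \<sigma> - {\<sigma> (p - 1), \<sigma> p} = T"
    then have "q = \<sigma> (p - 1) \<or> q = \<sigma> p" using q T by blast
    then show "p = i \<or> p = Suc i" using i that by (auto simp: inj)
  next
    assume "p = i \<or> p = Suc i"
    moreover have "\<sigma> (i - 1) \<notin> CP N \<sigma>" "\<sigma> (Suc i) \<notin> CP N \<sigma>"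
      using i Suc_peak_notin[of "i - 1" N \<sigma>] Suc_peak_notin[of i N \<sigma>] peak_positions_subset[of N \<sigma>]
      unfolding in_CP_iff[OF s] by auto
    then have "\<sigma> (i - 1) \<notin> T" "\<sigma> (Suc i) \<notin> T" unfolding T by simp_all
    ultimately show "CP N \<sigma> - {\<sigma> (p - 1), \<sigma> p} = T"
      unfolding T i(2)[symmetric] using q by (elim disjE) (simp_all add: i(2)[symmetric] insert_commute)
  qed
  then have "{p\<in>{2..N}. CP N \<sigma> - {\<sigma> (p - 1), \<sigma> p} = T} = {p\<in>{2..N}. p = i \<or> p = Suc i}" by blast
  also have "\<dots> = {i, Suc i}" using i by (auto simp: peak_positions_def)
  finally show ?thesis by simp
qed

text \<open>An insertion destroys at most one peak, since the entries at \<open>p - 1\<close> and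
  \<open>p\<close> are not both peaks.\<close>

lemma slots_empty:
  assumes s: "\<sigma> permutes {1..N}" and "CP N \<sigma> \<noteq> T"
    and "\<And>q. q \<in> {1..N} - T \<Longrightarrow> CP N \<sigma> \<noteq> insert q T"
  shows "{p\<in>{2..N}. CP N \<sigma> - {\<sigma> (p - 1), \<sigma> p} = T} = {}"
proof (rule ccontr)
  assume "{p\<in>{2..N}. CP N \<sigma> - {\<sigma> (p - 1), \<sigma> p} = T} \<noteq> {}"
  then obtain p where p: "p \<in> {2..N}" and T: "CP N \<sigma> - {\<sigma> (p - 1), \<sigma> p} = T" by blast
  have "\<not> (\<sigma> (p - 1) \<in> CP N \<sigma> \<and> \<sigma> p \<in> CP N \<sigma>)"
    using Suc_peak_notin[of "p - 1" N \<sigma>] p unfolding in_CP_iff[OF s] by auto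
  then obtain q where "q \<in> CP N \<sigma>" "CP N \<sigma> = insert q T" "q \<notin> T"
    using T assms(2) by blast
  then show False using assms(3) CP_subset[OF s] by blast
qed

section \<open>Recurrences for \<open>cp\<close>\<close>

lemma cp_Suc_card:
  "cp (Suc N) T =
     card {(p, \<sigma>). p \<in> {1..Suc N} \<and> \<sigma> permutes {1..N} \<and> CP (Suc N) (insert_max N p \<sigma>) = T}"
proof -
  let ?f = "\<lambda>(p, \<sigma>). insert_max N p \<sigma>"
  let ?A = "{(p, \<sigma>). p \<in> {1..Suc N} \<and> \<sigma> permutes {1..N} \<and> CP (Suc N) (insert_max N p \<sigma>) = T}"
  have sub: "?A \<subseteq> {1..Suc N} \<times> {\<sigma>. \<sigma> permutes {1..N}}" by auto
  have im: "?f ` ({1..Suc N} \<times> {\<sigma>. \<sigma> permutes {1..N}}) = {\<tau>. \<tau> permutes {1..Suc N}}"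
    using bij_betw_insert_max[of N] by (simp only: bij_betw_def)
  have A: "?A = {x \<in> {1..Suc N} \<times> {\<sigma>. \<sigma> permutes {1..N}}. CP (Suc N) (?f x) = T}" by auto
  have "f ` {x \<in> P. Q (f x)} = {y \<in> f ` P. Q y}" for f :: "nat \<times> (nat \<Rightarrow> nat) \<Rightarrow> nat \<Rightarrow> nat" and P Q
    by blast
  then have "?f ` ?A = {\<tau> \<in> ?f ` ({1..Suc N} \<times> {\<sigma>. \<sigma> permutes {1..N}}). CP (Suc N) \<tau> = T}"
    unfolding A .
  then have im': "?f ` ?A = CP_perms (Suc N) T"
    unfolding im CP_perms_def by simp
  have "inj_on ?f ?A"
    by (rule inj_on_subset[OF bij_betw_imp_inj_on[OF bij_betw_insert_max] sub])
  then show ?thesis unfolding cp_def im'[symmetric] by (rule card_image)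
qed

text \<open>Only the two end slots keep \<open>Suc N\<close> from being a peak; they are distinct
  since \<open>N \<ge> 1\<close>.\<close>

lemma cp_Suc:
  assumes "N \<ge> 1" and "Suc N \<notin> T"
  shows "cp (Suc N) T = 2 * cp N T"
proof -
  have "{(p, \<sigma>). p \<in> {1..Suc N} \<and> \<sigma> permutes {1..N} \<and> CP (Suc N) (insert_max N p \<sigma>) = T}
      = {1, Suc N} \<times> CP_perms N T" (is "?L = ?R")
  proof (rule set_eqI; clarify)
    fix p \<sigma>
    have "CP (Suc N) (insert_max N p \<sigma>) \<noteq> T" if "\<sigma> permutes {1..N}" "p \<in> {2..N}"
      using CP_insert_max_interior[OF that] assms(2) by blast
    moreover have "p \<in> {1..Suc N} \<longleftrightarrow> (p = 1 \<or> p = Suc N) \<or> p \<in> {2..N}" using assms(1) by auto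
    ultimately show "(p, \<sigma>) \<in> ?L \<longleftrightarrow> (p, \<sigma>) \<in> ?R"
      using CP_insert_max_end[of \<sigma> N p] unfolding CP_perms_def by auto
  qed
  then have "cp (Suc N) T = card ({1, Suc N} \<times> CP_perms N T)"
    unfolding cp_Suc_card by (rule arg_cong)
  also have "\<dots> = 2 * cp N T" using assms(1) by (simp add: card_cartesian_product cp_def)
  finally show ?thesis .
qed

text \<open>Double counting of pairs of a permutation and an interior slot: a permutation with peak
  set \<open>T\<close> has \<open>N - 1 - 2 |T|\<close> suitable slots, one with a single extra peak
  \<open>q\<close> has two, and any other has none.\<close>

lemma cp_Suc_insert:
  assumes N: "N \<ge> 1" and T: "T \<subseteq> {1..N}"
  shows "int (cp (Suc N) (insert (Suc N) T)) =
     (int N - 1 - 2 * int (card T)) * int (cp N T) + 2 * (\<Sum>q\<in>{1..N} - T. int (cp N (insert q T)))"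
proof -
  let ?P = "{\<sigma>. \<sigma> permutes {1..N}}"
  let ?slots = "\<lambda>\<sigma>. {p\<in>{2..N}. CP N \<sigma> - {\<sigma> (p - 1), \<sigma> p} = T}"
  have finP: "finite ?P" by (rule finite_permutations) simp
  have count: "(\<Sum>\<sigma>\<in>?P. of_bool (CP N \<sigma> = U)) = int (cp N U)" for U
  proof -
    have "?P \<inter> {\<sigma>. CP N \<sigma> = U} = CP_perms N U" by (auto simp: CP_perms_def)
    then show ?thesis using finP by (simp add: cp_def)
  qed
  have "{(p, \<sigma>). p \<in> {1..Suc N} \<and> \<sigma> permutes {1..N} \<and>
        CP (Suc N) (insert_max N p \<sigma>) = insert (Suc N) T}
      = prod.swap ` Sigma ?P ?slots" (is "?L = ?R")
  proof (rule set_eqI; clarify)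
    fix p \<sigma>
    have "CP (Suc N) (insert_max N p \<sigma>) \<noteq> insert (Suc N) T"
      if "\<sigma> permutes {1..N}" "p = 1 \<or> p = Suc N"
      using CP_insert_max_end[OF that] CP_subset[OF that(1)] by auto
    moreover have "CP (Suc N) (insert_max N p \<sigma>) = insert (Suc N) T \<longleftrightarrow>
        CP N \<sigma> - {\<sigma> (p - 1), \<sigma> p} = T" if "\<sigma> permutes {1..N}" "p \<in> {2..N}"
    proof -
      \<comment> \<open>\<open>Suc N\<close> lies in neither set, so it can be cancelled from both
        sides of the equation between the insertions.\<close>
      have "Suc N \<notin> CP N \<sigma> - {\<sigma> (p - 1), \<sigma> p}" "Suc N \<notin> T"
        using CP_subset[OF that(1)] T by auto
      then show ?thesis unfolding CP_insert_max_interior[OF that] by (metis insert_ident)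
    qed
    moreover have "p \<in> {1..Suc N} \<longleftrightarrow> (p = 1 \<or> p = Suc N) \<or> p \<in> {2..N}" using N by auto
    ultimately show "(p, \<sigma>) \<in> ?L \<longleftrightarrow> (p, \<sigma>) \<in> ?R"
      by (auto simp: image_iff)
  qed
  then have "cp (Suc N) (insert (Suc N) T) = card (Sigma ?P ?slots)"
    unfolding cp_Suc_card by (simp add: card_image)
  also have "\<dots> = (\<Sum>\<sigma>\<in>?P. card (?slots \<sigma>))" using finP by simp
  finally have "int (cp (Suc N) (insert (Suc N) T)) = (\<Sum>\<sigma>\<in>?P. int (card (?slots \<sigma>)))" by simp
  \<comment> \<open>Written with indicators, the slot count can be summed over all permutations,
    which turns each indicator into a value of \<open>cp\<close>.\<close>
  also have "\<dots> = (\<Sum>\<sigma>\<in>?P. (int N - 1 - 2 * int (card T)) * of_bool (CP N \<sigma> = T) +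
      2 * (\<Sum>q\<in>{1..N} - T. of_bool (CP N \<sigma> = insert q T)))"
  proof (rule sum.cong[OF refl])
    fix \<sigma> assume "\<sigma> \<in> ?P"
    then have s: "\<sigma> permutes {1..N}" by simp
    consider "CP N \<sigma> = T" | q where "q \<in> {1..N} - T" "CP N \<sigma> = insert q T"
      | "CP N \<sigma> \<noteq> T" "\<And>q. q \<in> {1..N} - T \<Longrightarrow> CP N \<sigma> \<noteq> insert q T" by blast
    then show "int (card (?slots \<sigma>)) = (int N - 1 - 2 * int (card T)) * of_bool (CP N \<sigma> = T) +
      2 * (\<Sum>q\<in>{1..N} - T. of_bool (CP N \<sigma> = insert q T))"
    proof cases
      case 1
      have "(\<Sum>q\<in>{1..N} - T. of_bool (CP N \<sigma> = insert q T)) = (0::int)"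
        using 1 by (intro sum.neutral) auto
      then show ?thesis using card_slots_away_from_peaks[OF s N 1] 1 by simp
    next
      case (2 q)
      have "(\<Sum>q'\<in>{1..N} - T. of_bool (CP N \<sigma> = insert q' T)) =
          (\<Sum>q'\<in>{1..N} - T. if q' = q then 1 else (0::int))"
        using 2 by (intro sum.cong) auto
      then have "(\<Sum>q'\<in>{1..N} - T. of_bool (CP N \<sigma> = insert q' T)) = (1::int)"
        using 2 by simp
      moreover have "CP N \<sigma> \<noteq> T" using 2 by auto
      ultimately show ?thesis using card_slots_at_peak[OF s _ 2(2)] 2 by simp
    next
      case 3
      then have "(\<Sum>q\<in>{1..N} - T. of_bool (CP N \<sigma> = insert q T)) = (0::int)"
        by (intro sum.neutral) auto
      then show ?thesis using slots_empty[OF s 3] 3(1) by (simp only: card.empty) simp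
    qed
  qed
  also have "\<dots> = (int N - 1 - 2 * int (card T)) * (\<Sum>\<sigma>\<in>?P. of_bool (CP N \<sigma> = T)) +
      2 * (\<Sum>q\<in>{1..N} - T. \<Sum>\<sigma>\<in>?P. of_bool (CP N \<sigma> = insert q T))"
    unfolding sum.distrib sum_distrib_left[symmetric] by (subst (2) sum.swap) (rule refl)
  finally show ?thesis unfolding count .
qed

text \<open>
  The two coefficients are the weights of an \<open>H\<close>-step and an \<open>R\<close>-step. The induction on \<open>K\<close> applies
  the insertion recurrence to all three counts; the sums over the extra peak \<open>q\<close> then cancel. For
  \<open>K = 0\<close> the truncated \<open>K - 1\<close> is harmless because of the factor \<open>K\<close>.
\<close>

lemma cp_non_peak_below_block:
  assumes N: "N \<ge> 1" and T: "T \<subseteq> {1..N}"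
  shows "int (cp (Suc N + K) (T \<union> {Suc N + 1..Suc N + K})) =
     2 * (int K + 1) * int (cp (N + K) (T \<union> {N + 1..N + K})) +
     int K * (int K + 1) * int (cp (N + (K - 1)) (T \<union> {N + 1..N + (K - 1)}))"
  using T
proof (induction K arbitrary: T)
  case 0
  then have "Suc N \<notin> T" by auto
  then show ?case using cp_Suc[OF N] by simp
next
  case (Suc K)
  have fin: "finite T" using Suc.prems finite_subset by blast
  \<comment> \<open>\<open>G\<close> has its run of \<open>j\<close> peaks directly above
    \<open>N\<close>; \<open>L\<close> skips \<open>Suc N\<close>. The set \<open>U\<close> stays
    variable because the recurrence adds a peak \<open>q\<close> to it.\<close>
  define G where "G j U = int (cp (N + j) (U \<union> {N + 1..N + j}))" for j U
  define L where "L j U = int (cp (Suc N + j) (U \<union> {Suc N + 1..Suc N + j}))" for j U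
  define a where "a = int N - 1 - 2 * int (card T)"
  \<comment> \<open>The run adds \<open>j\<close> to the size and to the number of peaks:
    \<open>(N + j) - 1 - 2 (|T| + j) = a - j\<close>.\<close>
  have G_Suc: "G (Suc j) T = (a - int j) * G j T + 2 * (\<Sum>q\<in>{1..N} - T. G j (insert q T))" for j
  proof -
    let ?I = "{N + 1..N + j}"
    have "T \<inter> ?I = {}" using Suc.prems by auto
    then have "card (T \<union> ?I) = card T + j" using fin by (simp add: card_Un_disjoint)
    moreover have "T \<union> {N + 1..N + Suc j} = insert (Suc (N + j)) (T \<union> ?I)" by auto
    moreover have "{1..N + j} - (T \<union> ?I) = {1..N} - T" by auto
    ultimately show ?thesis
      using cp_Suc_insert[of "N + j" "T \<union> ?I"] N Suc.prems unfolding G_def a_def by force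
  qed
  \<comment> \<open>The size is one larger than for \<open>G\<close>, hence
    \<open>a + 1 - j\<close>. The extra peak may now also be \<open>Suc N\<close>; it closes the gap
    and yields the term \<open>2 * G (Suc j) T\<close>.\<close>
  have L_Suc: "L (Suc j) T = (a + 1 - int j) * L j T +
      2 * (\<Sum>q\<in>{1..N} - T. L j (insert q T)) + 2 * G (Suc j) T" for j
  proof -
    let ?I = "{Suc N + 1..Suc N + j}"
    have "T \<inter> ?I = {}" using Suc.prems by auto
    then have card: "card (T \<union> ?I) = card T + j" using fin by (simp add: card_Un_disjoint)
    have ins: "T \<union> {Suc N + 1..Suc N + Suc j} = insert (Suc (Suc N + j)) (T \<union> ?I)" by auto
    have rest: "{1..Suc N + j} - (T \<union> ?I) = insert (Suc N) ({1..N} - T)" using Suc.prems by auto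
    have "insert (Suc N) (T \<union> ?I) = T \<union> {N + 1..N + Suc j}" by auto
    then have "int (cp (Suc N + j) (insert (Suc N) (T \<union> ?I))) = G (Suc j) T"
      unfolding G_def by simp
    moreover have "T \<union> ?I \<subseteq> {1..Suc N + j}" using Suc.prems by auto
    ultimately show ?thesis
      using cp_Suc_insert[of "Suc N + j" "T \<union> ?I"]
      unfolding L_def a_def ins card rest by (simp add: algebra_simps)
  qed
  have IH: "L K U = 2 * (int K + 1) * G K U + int K * (int K + 1) * G (K - 1) U"
    if "U \<subseteq> {1..N}" for U
    using Suc.IH[OF that] unfolding G_def L_def .
  have "(\<Sum>q\<in>{1..N} - T. L K (insert q T)) =
      (\<Sum>q\<in>{1..N} - T. 2 * (int K + 1) * G K (insert q T) + int K * (int K + 1) * G (K - 1) (insert q T))"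
    using Suc.prems by (intro sum.cong IH) auto
  then have "2 * (\<Sum>q\<in>{1..N} - T. L K (insert q T)) =
      2 * (int K + 1) * (2 * (\<Sum>q\<in>{1..N} - T. G K (insert q T))) +
      int K * (int K + 1) * (2 * (\<Sum>q\<in>{1..N} - T. G (K - 1) (insert q T)))"
    by (simp add: sum.distrib sum_distrib_left algebra_simps)
  moreover have "2 * (\<Sum>q\<in>{1..N} - T. G K (insert q T)) = G (Suc K) T - (a - int K) * G K T"
    using G_Suc[of K] by simp
  moreover have "int K * (int K + 1) * (2 * (\<Sum>q\<in>{1..N} - T. G (K - 1) (insert q T))) =
      int K * (int K + 1) * (G K T - (a + 1 - int K) * G (K - 1) T)"
    using G_Suc[of "K - 1"] by (cases K) simp_all
  ultimately have sumL: "2 * (\<Sum>q\<in>{1..N} - T. L K (insert q T)) =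
      2 * (int K + 1) * (G (Suc K) T - (a - int K) * G K T) +
      int K * (int K + 1) * (G K T - (a + 1 - int K) * G (K - 1) T)"
    by simp
  \<comment> \<open>\<open>a\<close> and \<open>G (K - 1) T\<close> drop out; the coefficient left
    on \<open>G K T\<close> is \<open>2 (K + 1) + K (K + 1) = (K + 1) (K + 2)\<close>.\<close>
  have "L (Suc K) T = 2 * (int (Suc K) + 1) * G (Suc K) T + int (Suc K) * (int (Suc K) + 1) * G K T"
    unfolding L_Suc sumL IH[OF Suc.prems] by (simp add: algebra_simps)
  then show ?case unfolding L_def G_def by simp
qed

section \<open>Recurrences for \<open>w\<close> from the last step of a path\<close>

lemma path_weight_snoc:
  "path_weight i p (P @ [s]) = path_weight i p P * step_weight i (foldl step_end p P) s"
  by (induction P arbitrary: p) auto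

text \<open>\<open>x - 2 y\<close> grows by one along an \<open>H\<close>-step and is constant along
  an \<open>R\<close>-step; the inequality is arranged to avoid subtraction.\<close>

lemma foldl_step_end_slope:
  "fst p + 2 * snd (foldl step_end p P) \<le> fst (foldl step_end p P) + 2 * snd p"
proof (induction P arbitrary: p)
  case (Cons s P)
  then show ?case using Cons[of "step_end p s"] by (cases p; cases s) auto
qed simp

lemma w_eq_0:
  assumes "N < r + 2 * k"
  shows "w i r N k = 0"
proof -
  have "foldl step_end (r, 0) P \<noteq> (N, k)" for P
    using foldl_step_end_slope[of "(r, 0)" P] assms by auto
  then have "cp_paths r N k = {}" unfolding cp_paths_def by simp
  then show ?thesis by (simp add: w_def)
qed

lemma w_refl: "w i r r 0 = 1"
proof -
  have "P = []" if "foldl step_end (r, 0) P = (r, 0)" for P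
    using fst_foldl_step_end[of "(r, 0)" P] that by simp
  then have "cp_paths r r 0 = {[]}" unfolding cp_paths_def by auto
  then show ?thesis by (simp add: w_def)
qed

text \<open>All paths in \<open>A\<close> end at \<open>(N, k)\<close>, so the weight of the
  appended step is a common factor.\<close>

lemma sum_path_weight_snoc:
  assumes "A \<subseteq> cp_paths r N k"
  shows "(\<Sum>P\<in>(\<lambda>P. P @ [s]) ` A. path_weight i (r, 0) P) =
     step_weight i (N, k) s * (\<Sum>P\<in>A. path_weight i (r, 0) P)"
proof -
  have "(\<Sum>P\<in>(\<lambda>P. P @ [s]) ` A. path_weight i (r, 0) P) = (\<Sum>P\<in>A. path_weight i (r, 0) (P @ [s]))"
    by (subst sum.reindex) (auto simp: inj_on_def)
  also have "\<dots> = (\<Sum>P\<in>A. step_weight i (N, k) s * path_weight i (r, 0) P)"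
    using assms by (intro sum.cong) (auto simp: path_weight_snoc cp_paths_def)
  finally show ?thesis by (simp add: sum_distrib_left)
qed

lemma step_end_eq_iff:
  "step_end p s = (x, y) \<longleftrightarrow>
     (s = H \<and> x \<ge> 1 \<and> p = (x - 1, y)) \<or> (s = R \<and> x \<ge> 2 \<and> y \<ge> 1 \<and> p = (x - 2, y - 1))"
  by (cases p; cases s) auto

text \<open>A path ending at height 0 cannot end with \<open>R\<close>, and the assumption excludes
  the empty path.\<close>

lemma w_Suc_0:
  assumes "Suc N \<noteq> r"
  shows "w i r (Suc N) 0 = (2 * i + 2) * w i r N 0"
proof -
  have "cp_paths r (Suc N) 0 = (\<lambda>P. P @ [H]) ` cp_paths r N 0"
  proof (rule set_eqI)
    fix P show "P \<in> cp_paths r (Suc N) 0 \<longleftrightarrow> P \<in> (\<lambda>P. P @ [H]) ` cp_paths r N 0"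
      using assms by (cases P rule: rev_cases) (auto simp: cp_paths_def step_end_eq_iff)
  qed
  then show ?thesis
    unfolding w_def using sum_path_weight_snoc[OF order_refl, where s = H] by simp
qed

text \<open>The end has positive height, so the path is nonempty: its last step is \<open>H\<close>
  from height \<open>k + 1\<close> or \<open>R\<close> from height \<open>k\<close>.\<close>

lemma w_Suc_Suc:
  "w i r (Suc (Suc N)) (Suc k) = (2 * i + 2 * (int k + 2)) * w i r (Suc N) (Suc k) +
     (int k + i + 1) * (int k + i + 2) * w i r N k"
proof -
  have "cp_paths r (Suc (Suc N)) (Suc k) =
      (\<lambda>P. P @ [H]) ` cp_paths r (Suc N) (Suc k) \<union> (\<lambda>P. P @ [R]) ` cp_paths r N k"
  proof (rule set_eqI)
    fix P
    show "P \<in> cp_paths r (Suc (Suc N)) (Suc k) \<longleftrightarrow>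
        P \<in> (\<lambda>P. P @ [H]) ` cp_paths r (Suc N) (Suc k) \<union> (\<lambda>P. P @ [R]) ` cp_paths r N k"
      by (cases P rule: rev_cases) (auto simp: cp_paths_def step_end_eq_iff)
  qed
  then have "w i r (Suc (Suc N)) (Suc k) =
      (\<Sum>P\<in>(\<lambda>P. P @ [H]) ` cp_paths r (Suc N) (Suc k). path_weight i (r, 0) P) +
      (\<Sum>P\<in>(\<lambda>P. P @ [R]) ` cp_paths r N k. path_weight i (r, 0) P)"
    unfolding w_def by (simp only:) (rule sum.union_disjoint; auto simp: finite_cp_paths)
  then show ?thesis
    by (simp add: w_def sum_path_weight_snoc[OF order_refl] algebra_simps)
qed

section \<open>Removing one gap below a run of peaks\<close>

text \<open>Induction on the gap \<open>g\<close>: for every \<open>i\<close>, the last-step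
  recurrence of \<open>w\<close> has the same coefficients as the recurrence for \<open>cp\<close>
  that shrinks the gap.\<close>

lemma cp_gap_and_block:
  assumes r: "r \<ge> 1" and T: "T \<subseteq> {1..r}"
  shows "int (cp (r + g + K) (T \<union> {r + g + 1..r + g + K})) =
     (\<Sum>i=0..K. w (int i) r (r + g + K - i) (K - i) * int (cp (r + i) (T \<union> {r + 1..r + i})))"
proof (induction g arbitrary: K)
  case 0
  \<comment> \<open>Without a gap the end point is too steep to reach unless \<open>i = K\<close>,
    when only the empty path remains.\<close>
  have "(\<Sum>i=0..K. w (int i) r (r + K - i) (K - i) * int (cp (r + i) (T \<union> {r + 1..r + i}))) =
      (\<Sum>i=0..K. if i = K then int (cp (r + K) (T \<union> {r + 1..r + K})) else 0)"
    by (intro sum.cong) (auto simp: w_refl w_eq_0)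
  then show ?case by simp
next
  case (Suc g)
  let ?f = "\<lambda>i. int (cp (r + i) (T \<union> {r + 1..r + i}))"
  \<comment> \<open>A path with parameter \<open>i\<close> ends at height \<open>K - i\<close>, so a
    last \<open>H\<close>-step weighs \<open>2 i + 2 (K - i + 1) = 2 (K + 1)\<close> and a last
    \<open>R\<close>-step, from height \<open>K - 1 - i\<close>, weighs \<open>K (K + 1)\<close>.
    For \<open>i = K\<close> the height is 0 and no \<open>R\<close>-step is possible.\<close>
  have W: "w (int i) r (r + Suc g + K - i) (K - i) = 2 * (int K + 1) * w (int i) r (r + g + K - i) (K - i) +
      (if i < K then int K * (int K + 1) * w (int i) r (r + g + (K - 1) - i) (K - 1 - i) else 0)"
    if "i \<in> {0..K}" for i
  proof (cases "i < K")
    case True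
    then obtain d where "K = i + Suc d" using less_imp_add_positive[OF True] by (metis Suc_pred)
    then show ?thesis using w_Suc_Suc[of "int i" r "r + g + d" d] by (simp add: algebra_simps)
  next
    case False
    then have "i = K" using that by simp
    then show ?thesis using w_Suc_0[of "r + g" r "int K"] by (simp add: algebra_simps)
  qed
  have "int (cp (r + Suc g + K) (T \<union> {r + Suc g + 1..r + Suc g + K})) =
     2 * (int K + 1) * int (cp (r + g + K) (T \<union> {r + g + 1..r + g + K})) +
     int K * (int K + 1) * int (cp (r + g + (K - 1)) (T \<union> {r + g + 1..r + g + (K - 1)}))"
    using cp_non_peak_below_block[of "r + g" T K] r T by (force simp del: of_nat_Suc)
  also have "\<dots> = 2 * (int K + 1) * (\<Sum>i=0..K. w (int i) r (r + g + K - i) (K - i) * ?f i) +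
      int K * (int K + 1) * (\<Sum>i=0..K - 1. w (int i) r (r + g + (K - 1) - i) (K - 1 - i) * ?f i)"
    unfolding Suc.IH ..
  \<comment> \<open>The sum is extended to \<open>K\<close> by a zero term. For \<open>K = 0\<close>
    the truncated bound \<open>K - 1\<close> leaves one spurious term, removed by the factor
    \<open>int K\<close>.\<close>
  also have "int K * (int K + 1) * (\<Sum>i=0..K - 1. w (int i) r (r + g + (K - 1) - i) (K - 1 - i) * ?f i) =
      (\<Sum>i=0..K. if i < K
        then int K * (int K + 1) * (w (int i) r (r + g + (K - 1) - i) (K - 1 - i) * ?f i) else 0)"
  proof (cases K)
    case (Suc d)
    have "(\<Sum>i=0..d. if i < Suc d then X i else 0) = (\<Sum>i=0..d. X i)" for X :: "nat \<Rightarrow> int"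
      by (rule sum.cong) auto
    then show ?thesis unfolding sum_distrib_left Suc by simp
  qed simp
  also have "2 * (int K + 1) * (\<Sum>i=0..K. w (int i) r (r + g + K - i) (K - i) * ?f i) + \<dots> =
      (\<Sum>i=0..K. w (int i) r (r + Suc g + K - i) (K - i) * ?f i)"
    unfolding sum_distrib_left sum.distrib[symmetric]
  proof (rule sum.cong[OF refl])
    fix i assume i: "i \<in> {0..K}"
    show "2 * (int K + 1) * (w (int i) r (r + g + K - i) (K - i) * ?f i) +
        (if i < K
          then int K * (int K + 1) * (w (int i) r (r + g + (K - 1) - i) (K - 1 - i) * ?f i) else 0) =
        w (int i) r (r + Suc g + K - i) (K - i) * ?f i"
      unfolding W[OF i] by (cases "i < K") (simp_all only: if_True if_False, simp_all add: distrib_right)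
  qed
  finally show ?case .
qed

text \<open>The \<open>d\<close> values above \<open>N\<close> are not peaks, and each doubles the
  count. This provides the power of 2 in the theorem.\<close>

lemma cp_add:
  assumes "N \<ge> 1" and "T \<subseteq> {1..N}"
  shows "cp (N + d) T = 2 ^ d * cp N T"
proof (induction d)
  case (Suc d)
  have "Suc (N + d) \<notin> T" using assms(2) by auto
  then show ?case using cp_Suc[of "N + d" T] assms(1) Suc by simp
qed simp

section \<open>Index tuples, entry by entry\<close>

text \<open>The tuples \<open>(i_0, ..., i_t)\<close>, padded with zeros; the cut \<open>t\<close>
  varies for an induction while \<open>m\<close> stays fixed in the bounds.\<close>

definition index_prefixes :: "nat \<Rightarrow> (nat \<Rightarrow> nat) \<Rightarrow> nat \<Rightarrow> (nat \<Rightarrow> nat) set" where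
  "index_prefixes m k t =
     {i. i 0 = 0 \<and> (\<forall>j\<in>{1..t}. i j \<le> k (m - j + 1) + i (j - 1)) \<and> (\<forall>j>t. i j = 0)}"

lemma index_prefixes_0: "index_prefixes m k 0 = {\<lambda>_. 0}"
proof -
  have "(i 0 = 0 \<and> (\<forall>j>0. i j = 0)) \<longleftrightarrow> i = (\<lambda>_. 0)" for i :: "nat \<Rightarrow> nat"
    unfolding fun_eq_iff by (metis neq0_conv)
  then show ?thesis by (simp add: index_prefixes_def)
qed

lemma index_tuples_eq:
  assumes "m \<ge> 1"
  shows "index_tuples m k = index_prefixes m k (m - 1)"
proof -
  have "j \<ge> m \<longleftrightarrow> j > m - 1" for j using assms by auto
  then show ?thesis unfolding index_tuples_def index_prefixes_def by (simp only:)
qed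

text \<open>The inverse reads off entry \<open>Suc t\<close> and resets it to the default 0. The
  bound \<open>k (m - t)\<close> is \<open>k (m - Suc t + 1)\<close>, which relies on
  \<open>Suc t \<le> m\<close>.\<close>

lemma bij_betw_index_prefixes_Suc:
  "bij_betw (\<lambda>(i, x). i(Suc t := x))
     (SIGMA i:index_prefixes m k t. {0..k (m - t) + i t}) (index_prefixes m k (Suc t))"
  (is "bij_betw ?f ?A ?B")
  if "Suc t \<le> m"
proof (rule bij_betw_byWitness[where f' = "\<lambda>i. (i(Suc t := 0), i (Suc t))"])
  have m: "m - Suc t + 1 = m - t" using that by simp
  show "\<forall>a\<in>?A. (\<lambda>i. (i(Suc t := 0), i (Suc t))) (?f a) = a"
    by (auto simp: index_prefixes_def fun_eq_iff)
  show "\<forall>i\<in>?B. ?f (i(Suc t := 0), i (Suc t)) = i" by auto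
  show "?f ` ?A \<subseteq> ?B"
    using m by (auto simp: index_prefixes_def le_Suc_eq)
  show "(\<lambda>i. (i(Suc t := 0), i (Suc t))) ` ?B \<subseteq> ?A"
  proof (intro image_subsetI SigmaI)
    fix i assume i: "i \<in> ?B"
    then have "i j \<le> k (m - j + 1) + i (j - 1)" if "j \<in> {1..Suc t}" for j
      using that unfolding index_prefixes_def by blast
    with i show "i(Suc t := 0) \<in> index_prefixes m k t"
      unfolding index_prefixes_def by auto
    show "i (Suc t) \<in> {0..k (m - t) + (i(Suc t := 0)) t}"
      using i m by (auto simp: index_prefixes_def dest!: bspec[where x = "Suc t"])
  qed
qed

lemma finite_index_prefixes: "Suc t \<le> m \<Longrightarrow> finite (index_prefixes m k t)"
proof (induction t)
  case (Suc t)
  have "finite (SIGMA i:index_prefixes m k t. {0..k (m - t) + i t})" using Suc by auto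
  then show ?case
    using bij_betw_finite[OF bij_betw_index_prefixes_Suc[of t m k]] Suc.prems by simp
qed (simp add: index_prefixes_0)

text \<open>Peels off the innermost of the nested sums, whose range depends on the previous
  index.\<close>

lemma sum_index_prefixes_Suc:
  assumes "Suc t \<le> m"
  shows "(\<Sum>i\<in>index_prefixes m k (Suc t). f i) =
     (\<Sum>i\<in>index_prefixes m k t. \<Sum>x=0..k (m - t) + i t. f (i(Suc t := x)))"
proof -
  have "(\<Sum>i\<in>index_prefixes m k (Suc t). f i) =
      (\<Sum>(i, x)\<in>(SIGMA i:index_prefixes m k t. {0..k (m - t) + i t}). f (i(Suc t := x)))"
    using sum.reindex_bij_betw[OF bij_betw_index_prefixes_Suc[OF assms], of f k]
    by (simp add: case_prod_unfold)
  also have "\<dots> = (\<Sum>i\<in>index_prefixes m k t. \<Sum>x=0..k (m - t) + i t. f (i(Suc t := x)))"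
    using finite_index_prefixes[OF assms, of k] by (subst sum.Sigma) auto
  finally show ?thesis .
qed

section \<open>Removing all gaps of a type, from the top down\<close>

theorem theorem3p2:
  fixes n m :: nat and S :: "nat set" and r k :: "nat \<Rightarrow> nat"
  assumes "n \<ge> 3"
    and "S \<subseteq> {3..n}"
    and "CP_perms n S \<noteq> {}"
    and "m \<ge> 2"
    and "has_type S m r k"
  shows "int (cp n S) =
    2 ^ (n - r m) *
    (\<Sum>i\<in>index_tuples m k.
       (\<Prod>j\<in>{1..m - 1}.
          w (int (i j)) (r (m - j)) (r (m - j + 1) + i (j - 1) - i j) (k (m - j + 1) + i (j - 1) - i j)) *
       int (cp (r 1 + i (m - 1)) {r 1 + 1 - k 1..r 1 + i (m - 1)}))"
proof -
  define B where "B l = {r l + 1 - k l..r l}" for l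
  define V where "V l = (\<Union>i\<in>{1..l}. B i)" for l
  have kpos: "k l > 0" if "l \<in> {1..m}" for l
    using assms(5) that unfolding has_type_def by blast
  have S: "S = V m" using assms(5) unfolding has_type_def V_def B_def by blast
  have gap: "r l + k (Suc l) + 1 \<le> r (Suc l)" if "l \<in> {1..m - 1}" for l
    using assms(5) that unfolding has_type_def by simp
  have B_sub: "B l \<subseteq> {3..n}" if "l \<in> {1..m}" for l
    using assms(2) that unfolding S V_def by blast
  \<comment> \<open>Both ends of a block lie in \<open>S\<close>, so its lower end
    \<open>r l + 1 - k l\<close> is at least 3 and the subtraction is not truncated.\<close>
  have kr: "k l \<le> r l" "r l \<in> {3..n}" if l: "l \<in> {1..m}" for l
  proof -
    have "r l \<in> B l" "r l + 1 - k l \<in> B l" using kpos[OF l] unfolding B_def by auto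
    then have "r l + 1 - k l \<in> {3..n}" "r l \<in> {3..n}" using B_sub[OF l] by blast+
    then show "k l \<le> r l" "r l \<in> {3..n}" by auto
  qed
  have V_sub: "V l \<subseteq> {1..r l}" if "1 \<le> l" "l \<le> m" for l
    using that
  proof (induction l rule: dec_induct)
    case base
    then show ?case using B_sub[of 1] unfolding V_def B_def by force
  next
    case (step l)
    have "V (Suc l) = V l \<union> B (Suc l)" unfolding V_def by (auto simp: atLeastAtMostSuc_conv)
    moreover have "B (Suc l) \<subseteq> {1..r (Suc l)}"
      using B_sub[of "Suc l"] step unfolding B_def by force
    moreover have "V l \<subseteq> {1..r (Suc l)}" using step gap[of l] by force
    ultimately show ?case by simp
  qed
  have V_Suc: "V (Suc l) \<union> {r (Suc l) + 1..r (Suc l) + x} =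
      V l \<union> {r (Suc l) + 1 - k (Suc l)..r (Suc l) + x}" if "l \<in> {1..m - 1}" for l x
  proof -
    have "V (Suc l) = V l \<union> B (Suc l)" unfolding V_def by (auto simp: atLeastAtMostSuc_conv)
    moreover have "B (Suc l) \<union> {r (Suc l) + 1..r (Suc l) + x} = {r (Suc l) + 1 - k (Suc l)..r (Suc l) + x}"
      unfolding B_def using kpos[of "Suc l"] that by auto
    ultimately show ?thesis by blast
  qed
  \<comment> \<open>The count for the lowest \<open>l\<close> blocks with the top one prolonged
    upwards by \<open>x\<close>. The proof leads from \<open>c m 0\<close> to the values
    \<open>c 1 x\<close>.\<close>
  define c where "c l x = int (cp (r l + x) (V l \<union> {r l + 1..r l + x}))" for l x
  have c_Suc: "c (Suc l) x = (\<Sum>y=0..k (Suc l) + x.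
      w (int y) (r l) (r (Suc l) + x - y) (k (Suc l) + x - y) * c l y)" if l: "l \<in> {1..m - 1}" for l x
  proof -
    \<comment> \<open>\<open>g\<close> is the number of values strictly between blocks
      \<open>l\<close> and \<open>Suc l\<close>; the run above this gap has
      \<open>k (Suc l) + x\<close> elements.\<close>
    define g where "g = r (Suc l) - k (Suc l) - r l"
    have g: "r (Suc l) = r l + g + k (Suc l)" unfolding g_def using gap[OF l] by simp
    have "V l \<subseteq> {1..r l}" using l by (intro V_sub) auto
    moreover have "r l \<ge> 1" using kr(2)[of l] l by (cases "l \<in> {1..m}") auto
    ultimately have "int (cp (r l + g + (k (Suc l) + x)) (V l \<union> {r l + g + 1..r l + g + (k (Suc l) + x)})) =
      (\<Sum>y=0..k (Suc l) + x. w (int y) (r l) (r l + g + (k (Suc l) + x) - y) (k (Suc l) + x - y) * c l y)"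
      unfolding c_def by (intro cp_gap_and_block)
    moreover have "r l + g + (k (Suc l) + x) = r (Suc l) + x" "r l + g + 1 = r (Suc l) + 1 - k (Suc l)"
      using g by simp_all
    ultimately show ?thesis unfolding c_def[of "Suc l"] V_Suc[OF l] by simp
  qed
  define W where "W i j = w (int (i j)) (r (m - j)) (r (m - j + 1) + i (j - 1) - i j)
      (k (m - j + 1) + i (j - 1) - i j)" for i j
  \<comment> \<open>After \<open>t\<close> gaps have been removed, \<open>i t\<close> is the length
    by which block \<open>m - t\<close> is prolonged.\<close>
  have "c m 0 = (\<Sum>i\<in>index_prefixes m k t. (\<Prod>j\<in>{1..t}. W i j) * c (m - t) (i t))" if "t \<le> m - 1" for t
    using that
  proof (induction t)
    case 0
    then show ?case by (simp add: index_prefixes_0)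
  next
    case (Suc t)
    define l where "l = m - Suc t"
    have l: "l \<in> {1..m - 1}" "m - t = Suc l" using Suc.prems by (auto simp: l_def)
    have "c m 0 = (\<Sum>i\<in>index_prefixes m k t. (\<Prod>j\<in>{1..t}. W i j) * c (m - t) (i t))"
      using Suc by simp
    also have "\<dots> = (\<Sum>i\<in>index_prefixes m k t. \<Sum>y=0..k (m - t) + i t.
        (\<Prod>j\<in>{1..Suc t}. W (i(Suc t := y)) j) * c (m - Suc t) ((i(Suc t := y)) (Suc t)))"
    proof (rule sum.cong[OF refl])
      fix i
      have "(\<Prod>j\<in>{1..Suc t}. W (i(Suc t := y)) j) =
          (\<Prod>j\<in>{1..t}. W i j) * w (int y) (r l) (r (Suc l) + i t - y) (k (Suc l) + i t - y)" for y
      proof -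
        \<comment> \<open>For \<open>j \<le> t\<close> the factor reads only the entries
          \<open>j\<close> and \<open>j - 1\<close>, which the update at \<open>Suc t\<close> leaves
          alone.\<close>
        have "(\<Prod>j\<in>{1..t}. W (i(Suc t := y)) j) = (\<Prod>j\<in>{1..t}. W i j)"
          by (intro prod.cong) (auto simp: W_def)
        moreover have "W (i(Suc t := y)) (Suc t) =
            w (int y) (r l) (r (Suc l) + i t - y) (k (Suc l) + i t - y)"
          using l by (simp add: W_def l_def)
        ultimately show ?thesis by simp
      qed
      then show "(\<Prod>j\<in>{1..t}. W i j) * c (m - t) (i t) = (\<Sum>y=0..k (m - t) + i t.
        (\<Prod>j\<in>{1..Suc t}. W (i(Suc t := y)) j) * c (m - Suc t) ((i(Suc t := y)) (Suc t)))"
        by (simp add: l(2) l_def[symmetric] c_Suc[OF l(1)] sum_distrib_left mult.assoc)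
    qed
    also have "\<dots> = (\<Sum>i\<in>index_prefixes m k (Suc t). (\<Prod>j\<in>{1..Suc t}. W i j) * c (m - Suc t) (i (Suc t)))"
      using Suc.prems by (intro sum_index_prefixes_Suc[symmetric]) simp
    finally show ?case .
  qed
  from this[of "m - 1"]
  have "c m 0 = (\<Sum>i\<in>index_tuples m k. (\<Prod>j\<in>{1..m - 1}. W i j) * c 1 (i (m - 1)))"
    using assms(4) by (simp add: index_tuples_eq)
  moreover have "c 1 x = int (cp (r 1 + x) {r 1 + 1 - k 1..r 1 + x})" for x
  proof -
    have "V 1 \<union> {r 1 + 1..r 1 + x} = {r 1 + 1 - k 1..r 1 + x}"
      using kpos[of 1] assms(4) unfolding V_def B_def by auto
    then show ?thesis unfolding c_def by simp
  qed
  moreover have "int (cp n S) = 2 ^ (n - r m) * c m 0"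
    using cp_add[of "r m" "V m" "n - r m"] V_sub[of m] kr(2)[of m] assms(4) by (simp add: c_def S)
  ultimately show ?thesis unfolding W_def by simp
qed

end
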